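(* Let $n\ge 1$ be an integer and let $X$ be a non trivial real Hamiltonian polynomial vector field of even degree $2n$ of the form $$X=X_{lin}+X_2+X_4+\dots+X_{2n}.$$ Then $X$ is nonisochronous.
   Context: Planar real vector fields are written in complex form: $\mathbb{R}^2$ is identified with $\mathbb{C}$ by the complex coordinate $x$, with conjugate $\bar x$. Set $X_{lin}=i(x\partial_x-\bar x\partial_{\bar x})$ and, for $r\ge 2$, $X_r=P_r(x,\bar x)\partial_x+\overline{P_r(x,\bar x)}\,\partial_{\bar x}$, where $P_r(x,\bar x)=\sum_{j=0}^{r}p_{r-j-1,j}\,x^{r-j}\bar x^{j}$ is homogeneous of degree $r$ with complex coefficients. The field is real Hamiltonian if, in real coordinates $x=u+iv$, it is of the form $-\partial_vH\,\partial_u+\partial_uH\,\partial_v$ for a real polynomial $H(u,v)$. Its degree is the maximal degree of $\partial_uH$ and $\partial_vH$ (so degree $2n$ means $X_{2n}\neq 0$). Non trivial means that $X\ne X_{lin}$. The origin is then a center. It is isochronous if all periodic orbits in a neighbourhood of the origin have the same period, and $X$ is called nonisochronous if its center at the origin is not isochronous. *)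

theory Defs
  imports "HOL-Analysis.Analysis" "HOL-Computational_Algebra.Polynomial"
begin

text \<open>
  A real planar vector field \<open>P \<partial>\<^sub>x + cnj P \<partial>\<^sub>y\<close> (where \<open>y = cnj x\<close>) is represented by its
  \<open>\<partial>\<^sub>x\<close>-component, the function \<open>P :: complex \<Rightarrow> complex\<close>. In coordinates \<open>x = u + i v\<close> this is
  the field \<open>Re P \<partial>\<^sub>u + Im P \<partial>\<^sub>v\<close>, and its integral curves solve \<open>\<gamma>' = P(\<gamma>)\<close>.
\<close>

definition X_lin :: "complex \<Rightarrow> complex" where
  "X_lin x = \<i> * x"

text \<open>
  The first index of a coefficient is the exponent of \<open>x\<close> minus one, hence an integer that may
  be \<open>-1\<close>. As the indices of the coefficients in degree \<open>r\<close> add up to \<open>r - 1\<close>, a single family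
  \<open>p\<close> provides independent coefficients for all degrees.
\<close>

definition X_hom :: "(int \<Rightarrow> nat \<Rightarrow> complex) \<Rightarrow> nat \<Rightarrow> complex \<Rightarrow> complex" where
  "X_hom p r x = (\<Sum>j\<le>r. p (int r - int j - 1) j * x ^ (r - j) * cnj x ^ j)"

text \<open>
  A real polynomial in \<open>u\<close>, \<open>v\<close> is a polynomial in \<open>v\<close> whose coefficients are polynomials in \<open>u\<close>.
\<close>

definition eval2 :: "real poly poly \<Rightarrow> real \<Rightarrow> real \<Rightarrow> real" where
  "eval2 H u v = poly (poly H [:v:]) u"

definition partial_u :: "real poly poly \<Rightarrow> real poly poly" where
  "partial_u H = map_poly pderiv H"

definition partial_v :: "real poly poly \<Rightarrow> real poly poly" where
  "partial_v H = pderiv H"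

definition total_degree :: "real poly poly \<Rightarrow> nat" where
  "total_degree H = Max (insert 0 {i + j |i j. coeff (coeff H j) i \<noteq> 0})"

lemma finite_total_degree: "finite {i + j |i j. coeff (coeff H j) i \<noteq> 0}"
  for H :: "real poly poly"
proof -
  have "{i + j |i j. coeff (coeff H j) i \<noteq> 0}
        \<subseteq> (\<Union>j\<in>{..degree H}. (\<lambda>i. i + j) ` {..degree (coeff H j)})"
    by (force intro: le_degree)
  then show ?thesis
    by (rule finite_subset) auto
qed

lemma eval2_pCons: "eval2 (pCons a H) u v = poly a u + v * eval2 H u v"
  by (simp add: eval2_def)

lemma has_partial_u:
  "((\<lambda>u. eval2 H u v) has_real_derivative eval2 (partial_u H) u v) (at u)"
proof (induction H)
  case 0
  then show ?case by (simp add: eval2_def partial_u_def)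
next
  case (pCons a H)
  have "eval2 (partial_u (pCons a H)) u v = poly (pderiv a) u + v * eval2 (partial_u H) u v"
    using pCons.hyps by (simp add: partial_u_def map_poly_pCons eval2_pCons)
  then show ?case
    unfolding eval2_pCons by (auto intro!: derivative_eq_intros pCons.IH poly_DERIV)
qed

lemma has_partial_v:
  "((\<lambda>v. eval2 H u v) has_real_derivative eval2 (partial_v H) u v) (at v)"
proof (induction H)
  case 0
  then show ?case by (simp add: eval2_def partial_v_def)
next
  case (pCons a H)
  have "eval2 (partial_v (pCons a H)) u v = eval2 H u v + v * eval2 (partial_v H) u v"
    by (simp add: partial_v_def pderiv_pCons eval2_def)
  then show ?case
    unfolding eval2_pCons by (auto intro!: derivative_eq_intros pCons.IH)
qed

definition hamiltonian_field :: "real poly poly \<Rightarrow> complex \<Rightarrow> complex" where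
  "hamiltonian_field H x =
     Complex (- eval2 (partial_v H) (Re x) (Im x)) (eval2 (partial_u H) (Re x) (Im x))"

definition hamiltonian_degree :: "real poly poly \<Rightarrow> nat" where
  "hamiltonian_degree H = max (total_degree (partial_u H)) (total_degree (partial_v H))"

text \<open>
  The period of a periodic orbit is its least positive period. Equilibria are thereby excluded,
  since a constant curve has no least positive period.
\<close>

definition periodic_orbit :: "(complex \<Rightarrow> complex) \<Rightarrow> (real \<Rightarrow> complex) \<Rightarrow> real \<Rightarrow> bool" where
  "periodic_orbit X \<gamma> T \<longleftrightarrow>
     (\<forall>t. (\<gamma> has_vector_derivative X (\<gamma> t)) (at t)) \<and>
     0 < T \<and> (\<forall>t. \<gamma> (t + T) = \<gamma> t) \<and>
     (\<forall>S. 0 < S \<and> S < T \<longrightarrow> (\<exists>t. \<gamma> (t + S) \<noteq> \<gamma> t))"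

definition isochronous :: "(complex \<Rightarrow> complex) \<Rightarrow> bool" where
  "isochronous X \<longleftrightarrow>
     (\<exists>U T. open U \<and> 0 \<in> U \<and>
        (\<forall>\<gamma> S. periodic_orbit X \<gamma> S \<and> range \<gamma> \<subseteq> U \<longrightarrow> S = T))"

abbreviation nonisochronous :: "(complex \<Rightarrow> complex) \<Rightarrow> bool" where
  "nonisochronous X \<equiv> \<not> isochronous X"

end

theory Submission
  imports Defs
begin

text \<open>
  In polar coordinates \<open>x = r cis \<theta>\<close> the angular velocity of the field is
  \<open>1 + (\<Sum>k=1..n. D k \<theta> * r ^ (2 * k - 1))\<close>, and since the field is Hamiltonian, its energy is
  \<open>r\<^sup>2 / 2 + (\<Sum>k=1..n. D k \<theta> * r ^ (2 * k + 1) / (2 * k + 1))\<close> (\<open>angular_component\<close>,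
  \<open>polar_energy_eq\<close>). As the nonlinear homogeneous parts have even degree,
  \<open>D k (\<theta> + pi) = - D k \<theta>\<close>, so every \<open>D k\<close> has mean zero.

  Near the origin the level curve on which the energy is \<open>s\<^sup>2 / 2\<close> is a graph \<open>r = radius s \<theta>\<close>, and
  it is a periodic orbit whose least period is the integral of the inverse of the angular velocity
  over one turn (\<open>level_curve_periodic_orbit\<close>). The terms of the period that are linear in the \<open>D k\<close>
  vanish in every order, because of mean zero; hence nothing can cancel the lowest quadratic term.
  Let \<open>a\<close> be the least index with \<open>D a\<close> not identically zero. The lowest quadratic term is a positive
  multiple of \<open>s ^ (2 * (2 * a - 1))\<close> times the integral of the square of \<open>D a\<close>. Its sign has a
  geometric reason: to leading order, the level curve runs inside the circle of radius \<open>s\<close> where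
  \<open>D a\<close> speeds the motion up, and outside it where \<open>D a\<close> slows the motion down; as the
  perturbation grows with the radius, the loss outweighs the gain (\<open>speed_expansion\<close>). Hence the period is larger than
  \<open>2 * pi\<close> on small orbits, while it tends to \<open>2 * pi\<close> at the origin, so it is not constant
  (\<open>period_not_constant\<close>). Finally, a nontrivial field has some nonzero \<open>D k\<close>
  (\<open>angular_coeff_nonzero\<close>).
\<close>

section \<open>Time changes and implicit functions on the line\<close>

text \<open>
  If the angle of a motion has speed \<open>1 / f\<close>, then the time needed to reach an angle is an
  antiderivative \<open>\<tau>\<close> of \<open>f\<close>, and the motion \<open>\<Theta>\<close> is the inverse function of \<open>\<tau>\<close>. The uniform
  lower bound on \<open>f\<close> makes \<open>\<tau>\<close> surjective, so that the motion exists for all time; periodicity of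
  \<open>f\<close> makes \<open>\<tau> (\<theta> + L) - \<tau> \<theta>\<close> constant, so that every turn takes the same time.
\<close>

lemma time_change:
  fixes f :: "real \<Rightarrow> real"
  assumes cont: "continuous_on UNIV f"
    and "0 < c" and lower: "\<And>\<theta>. c \<le> f \<theta>"
    and "0 < L" and periodic: "\<And>\<theta>. f (\<theta> + L) = f \<theta>"
  obtains \<Theta> where "\<And>t. (\<Theta> has_real_derivative 1 / f (\<Theta> t)) (at t)" "strict_mono \<Theta>" "\<Theta> 0 = 0"
    "\<And>t. \<Theta> (t + integral {0..L} f) = \<Theta> t + L"
proof -
  have pos: "0 < f \<theta>" for \<theta>
    using \<open>0 < c\<close> lower[of \<theta>] by linarith
  have "isCont f \<theta>" for \<theta>
    using cont by (simp add: continuous_on_eq_continuous_at)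
  then obtain \<tau>0 where "\<And>\<theta>::real. (\<tau>0 has_vector_derivative f \<theta>) (at \<theta>)"
    using einterval_antiderivative[of "-\<infinity>" "\<infinity>" f] by auto
  moreover define \<tau> where "\<tau> \<theta> = \<tau>0 \<theta> - \<tau>0 0" for \<theta>
  ultimately have \<tau>: "(\<tau> has_real_derivative f \<theta>) (at \<theta>)" for \<theta>
    unfolding \<tau>_def[abs_def]
    by (auto intro!: derivative_eq_intros simp: has_real_derivative_iff_has_vector_derivative)
  have cont_\<tau>: "isCont \<tau> \<theta>" for \<theta>
    using \<tau> DERIV_isCont by blast
  have mono: "\<tau> x < \<tau> y" if "x < y" for x y
    by (rule DERIV_pos_imp_increasing[OF that]) (use \<tau> pos in blast)
  then have inj: "inj \<tau>"
    by (metis injI linorder_less_linear order_less_irrefl)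
  have growth: "c * (y - x) \<le> \<tau> y - \<tau> x" if "x < y" for x y
  proof -
    obtain z where "\<tau> y - \<tau> x = (y - x) * f z"
      using MVT2[OF \<open>x < y\<close>, of \<tau> f] \<tau> by blast
    then show ?thesis
      using that lower[of z] by (simp add: mult.commute)
  qed
  have surj: "\<exists>x. \<tau> x = t" for t
  proof -
    define M where "M = \<bar>t\<bar> / c + 1"
    have M: "0 < M" "c * M \<ge> \<bar>t\<bar>"
      using \<open>0 < c\<close> by (auto simp: M_def field_simps add_pos_nonneg)
    have "\<tau> 0 = 0"
      by (simp add: \<tau>_def)
    then have "\<tau> (-M) \<le> t" "t \<le> \<tau> M"
      using growth[of "-M" 0] growth[of 0 M] M by auto
    then show ?thesis
      using IVT[of \<tau> "-M" t M] M cont_\<tau> by auto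
  qed
  define \<Theta> where "\<Theta> = inv \<tau>"
  have \<tau>\<Theta>: "\<tau> (\<Theta> t) = t" for t
    using surj[of t] unfolding \<Theta>_def by (metis f_inv_into_f rangeI)
  have \<Theta>\<tau>: "\<Theta> (\<tau> x) = x" for x
    by (simp add: \<Theta>_def inj)
  have cont_\<Theta>: "isCont \<Theta> t" for t
    using isCont_inverse_function[where f=\<tau> and g=\<Theta> and x="\<Theta> t" and d=1] by (simp add: \<Theta>\<tau> \<tau>\<Theta> cont_\<tau>)
  have deriv: "(\<Theta> has_real_derivative 1 / f (\<Theta> t)) (at t)" for t
    using DERIV_inverse_function[where f=\<tau> and g=\<Theta> and x=t and D="f (\<Theta> t)" and a="t - 1" and b="t + 1"] pos[of "\<Theta> t"]
    by (simp add: \<tau> \<tau>\<Theta> cont_\<Theta> inverse_eq_divide)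
  have strict: "strict_mono \<Theta>"
  proof (rule strict_monoI)
    show "\<Theta> x < \<Theta> y" if "x < y" for x y
      by (rule DERIV_pos_imp_increasing[OF that]) (use deriv pos in force)
  qed
  have zero: "\<Theta> 0 = 0"
    using \<Theta>\<tau>[of 0] by (simp add: \<tau>_def)
  have "((\<lambda>\<theta>. \<tau> (\<theta> + L) - \<tau> \<theta>) has_real_derivative 0) (at \<theta>)" for \<theta>
    using DERIV_diff[OF DERIV_shift[THEN iffD1, OF \<tau>[of "\<theta> + L"]] \<tau>[of \<theta>]]
    by (simp add: periodic)
  then have "\<tau> (\<theta> + L) - \<tau> \<theta> = \<tau> (0 + L) - \<tau> 0" for \<theta>
    by (intro DERIV_isconst_all) auto
  moreover have "(f has_integral (\<tau> L - \<tau> 0)) {0..L}"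
    using \<open>0 < L\<close> \<tau>
    by (intro fundamental_theorem_of_calculus)
      (auto simp: has_real_derivative_iff_has_vector_derivative intro: has_vector_derivative_at_within)
  ultimately have "\<tau> (\<theta> + L) = \<tau> \<theta> + integral {0..L} f" for \<theta>
    by (smt (verit) add.left_neutral integral_unique)
  then have "\<Theta> (t + integral {0..L} f) = \<Theta> t + L" for t
    by (metis \<tau>\<Theta> \<Theta>\<tau>)
  then show thesis
    using that deriv strict zero by blast
qed

text \<open>
  At a slightly smaller and a slightly larger radius than \<open>\<rho> \<theta>\<close> the values of \<open>F\<close> enclose the level
  \<open>w\<close> strictly, and they still do so at nearby angles; monotonicity keeps the root in between.
\<close>

lemma implicit_root_isCont:
  fixes F :: "real \<Rightarrow> real \<Rightarrow> real"
  assumes mono: "\<And>x y \<phi>. \<lbrakk>a < x; x < y; y < b\<rbrakk> \<Longrightarrow> F x \<phi> < F y \<phi>"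
    and cont: "\<And>x. \<lbrakk>a < x; x < b\<rbrakk> \<Longrightarrow> isCont (F x) \<theta>"
    and root: "\<And>\<phi>. a < \<rho> \<phi> \<and> \<rho> \<phi> < b \<and> F (\<rho> \<phi>) \<phi> = w"
  shows "isCont \<rho> \<theta>"
  unfolding isCont_def
proof (rule order_tendstoI)
  fix y assume "y < \<rho> \<theta>"
  define x where "x = max y ((a + \<rho> \<theta>) / 2)"
  have x: "a < x" "x < \<rho> \<theta>" "y \<le> x" "x < b"
    using \<open>y < \<rho> \<theta>\<close> root[of \<theta>] by (auto simp: x_def max_def)
  have "F x \<theta> < w"
    using mono[of x "\<rho> \<theta>" \<theta>] x root[of \<theta>] by auto
  then have "\<forall>\<^sub>F \<phi> in at \<theta>. F x \<phi> < w"
    using cont[of x] x by (auto simp: isCont_def intro: order_tendstoD)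
  then show "\<forall>\<^sub>F \<phi> in at \<theta>. y < \<rho> \<phi>"
  proof (rule eventually_mono)
    fix \<phi> assume "F x \<phi> < w"
    then have "\<not> \<rho> \<phi> \<le> x"
      using mono[of "\<rho> \<phi>" x \<phi>] root[of \<phi>] x by (auto simp: le_less)
    then show "y < \<rho> \<phi>"
      using x by linarith
  qed
next
  fix y assume "\<rho> \<theta> < y"
  define x where "x = min y ((b + \<rho> \<theta>) / 2)"
  have x: "x < b" "\<rho> \<theta> < x" "x \<le> y" "a < x"
    using \<open>\<rho> \<theta> < y\<close> root[of \<theta>] by (auto simp: x_def min_def)
  have "w < F x \<theta>"
    using mono[of "\<rho> \<theta>" x \<theta>] x root[of \<theta>] by auto
  then have "\<forall>\<^sub>F \<phi> in at \<theta>. w < F x \<phi>"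
    using cont[of x] x by (auto simp: isCont_def intro: order_tendstoD)
  then show "\<forall>\<^sub>F \<phi> in at \<theta>. \<rho> \<phi> < y"
  proof (rule eventually_mono)
    fix \<phi> assume "w < F x \<phi>"
    then have "\<not> x \<le> \<rho> \<phi>"
      using mono[of x "\<rho> \<phi>" \<phi>] root[of \<phi>] x by (auto simp: le_less)
    then show "\<rho> \<phi> < y"
      using x by linarith
  qed
qed

text \<open>
  A one-dimensional implicit function theorem for a root that is already known to exist at all
  angles. By the mean value theorem in the radius, the increment of \<open>\<rho>\<close> is minus the increment of
  \<open>F (\<rho> \<theta>)\<close> in the angle, divided by \<open>F'\<close> at an intermediate radius \<open>\<xi>\<close>; and \<open>\<xi>\<close> tends to \<open>\<rho> \<theta>\<close>
  because \<open>\<rho>\<close> is continuous. Joint continuity of \<open>F'\<close> is only asked for along curves of radii.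
\<close>

lemma implicit_root_DERIV:
  fixes F :: "real \<Rightarrow> real \<Rightarrow> real"
  assumes deriv: "\<And>x \<phi>. \<lbrakk>a < x; x < b\<rbrakk> \<Longrightarrow> ((\<lambda>r. F r \<phi>) has_real_derivative F' x \<phi>) (at x)"
    and pos: "\<And>x \<phi>. \<lbrakk>a < x; x < b\<rbrakk> \<Longrightarrow> 0 < F' x \<phi>"
    and cont': "\<And>\<xi>. isCont \<xi> \<theta> \<Longrightarrow> isCont (\<lambda>\<phi>. F' (\<xi> \<phi>) \<phi>) \<theta>"
    and cont: "\<And>x. \<lbrakk>a < x; x < b\<rbrakk> \<Longrightarrow> isCont (F x) \<theta>"
    and root: "\<And>\<phi>. a < \<rho> \<phi> \<and> \<rho> \<phi> < b \<and> F (\<rho> \<phi>) \<phi> = w"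
    and tangential: "(F (\<rho> \<theta>) has_real_derivative d) (at \<theta>)"
  shows "(\<rho> has_real_derivative - d / F' (\<rho> \<theta>) \<theta>) (at \<theta>)"
proof -
  have mono: "F x \<phi> < F y \<phi>" if "a < x" "x < y" "y < b" for x y \<phi>
    by (rule DERIV_pos_imp_increasing[OF \<open>x < y\<close>])
      (use deriv pos that in \<open>metis order_less_le_trans order_le_less_trans\<close>)
  have \<rho>: "isCont \<rho> \<theta>"
    by (rule implicit_root_isCont[of a b F]) (use mono cont root in auto)
  have "\<exists>\<xi>. \<bar>\<xi> - \<rho> \<theta>\<bar> \<le> \<bar>\<rho> \<phi> - \<rho> \<theta>\<bar> \<and> a < \<xi> \<and> \<xi> < b \<and>
      F (\<rho> \<phi>) \<phi> - F (\<rho> \<theta>) \<phi> = (\<rho> \<phi> - \<rho> \<theta>) * F' \<xi> \<phi>" for \<phi>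
  proof (cases "\<rho> \<phi>" "\<rho> \<theta>" rule: linorder_cases)
    case less
    then obtain z where "\<rho> \<phi> < z" "z < \<rho> \<theta>" "F (\<rho> \<theta>) \<phi> - F (\<rho> \<phi>) \<phi> = (\<rho> \<theta> - \<rho> \<phi>) * F' z \<phi>"
      using MVT2[OF less, of "\<lambda>r. F r \<phi>" "\<lambda>r. F' r \<phi>"] deriv root
      by (metis order_less_le_trans order_le_less_trans)
    then show ?thesis
      using root[of \<phi>] root[of \<theta>] by (intro exI[of _ z]) (auto simp: algebra_simps)
  next
    case equal
    then show ?thesis using root by (intro exI[of _ "\<rho> \<theta>"]) auto
  next
    case greater
    then obtain z where "\<rho> \<theta> < z" "z < \<rho> \<phi>" "F (\<rho> \<phi>) \<phi> - F (\<rho> \<theta>) \<phi> = (\<rho> \<phi> - \<rho> \<theta>) * F' z \<phi>"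
      using MVT2[OF greater, of "\<lambda>r. F r \<phi>" "\<lambda>r. F' r \<phi>"] deriv root
      by (metis order_less_le_trans order_le_less_trans)
    then show ?thesis
      using root[of \<phi>] root[of \<theta>] by (intro exI[of _ z]) auto
  qed
  then obtain \<xi> where \<xi>: "\<And>\<phi>. \<bar>\<xi> \<phi> - \<rho> \<theta>\<bar> \<le> \<bar>\<rho> \<phi> - \<rho> \<theta>\<bar>"
      "\<And>\<phi>. a < \<xi> \<phi>" "\<And>\<phi>. \<xi> \<phi> < b"
      "\<And>\<phi>. F (\<rho> \<phi>) \<phi> - F (\<rho> \<theta>) \<phi> = (\<rho> \<phi> - \<rho> \<theta>) * F' (\<xi> \<phi>) \<phi>"
    by metis
  have "((\<lambda>\<phi>. \<rho> \<phi> - \<rho> \<theta>) \<longlongrightarrow> 0) (at \<theta>)"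
    using \<rho> by (simp add: isCont_def LIM_zero)
  then have "((\<lambda>\<phi>. \<xi> \<phi> - \<rho> \<theta>) \<longlongrightarrow> 0) (at \<theta>)"
    by (rule Lim_null_comparison[rotated, OF tendsto_rabs_zero]) (use \<xi>(1) in simp)
  moreover have "\<xi> \<theta> = \<rho> \<theta>"
    using \<xi>(1)[of \<theta>] by simp
  ultimately have "isCont \<xi> \<theta>"
    by (simp add: isCont_def LIM_zero_iff)
  then have "((\<lambda>\<phi>. F' (\<xi> \<phi>) \<phi>) \<longlongrightarrow> F' (\<rho> \<theta>) \<theta>) (at \<theta>)"
    using cont' \<open>\<xi> \<theta> = \<rho> \<theta>\<close> by (fastforce simp: isCont_def)
  moreover have "((\<lambda>\<phi>. (F (\<rho> \<theta>) \<phi> - F (\<rho> \<theta>) \<theta>) / (\<phi> - \<theta>)) \<longlongrightarrow> d) (at \<theta>)"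
    using tangential by (simp add: has_field_derivative_iff)
  moreover have "F' (\<rho> \<theta>) \<theta> \<noteq> 0"
    using pos root by (metis less_irrefl)
  ultimately have "((\<lambda>\<phi>. - ((F (\<rho> \<theta>) \<phi> - F (\<rho> \<theta>) \<theta>) / (\<phi> - \<theta>)) / F' (\<xi> \<phi>) \<phi>)
      \<longlongrightarrow> - d / F' (\<rho> \<theta>) \<theta>) (at \<theta>)"
    by (intro tendsto_intros)
  moreover have "- ((F (\<rho> \<theta>) \<phi> - F (\<rho> \<theta>) \<theta>) / (\<phi> - \<theta>)) / F' (\<xi> \<phi>) \<phi>
      = (\<rho> \<phi> - \<rho> \<theta>) / (\<phi> - \<theta>)" for \<phi>
  proof -
    have "- (F (\<rho> \<theta>) \<phi> - F (\<rho> \<theta>) \<theta>) = (\<rho> \<phi> - \<rho> \<theta>) * F' (\<xi> \<phi>) \<phi>"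
      using \<xi>(4)[of \<phi>] root[of \<phi>] root[of \<theta>] by simp
    moreover have "F' (\<xi> \<phi>) \<phi> \<noteq> 0"
      using pos \<xi> by (metis less_irrefl)
    ultimately show ?thesis
      by (simp add: divide_simps)
  qed
  ultimately show ?thesis
    by (simp add: has_field_derivative_iff)
qed

section \<open>Level curves as periodic orbits\<close>

text \<open>
  For the vector field considered below, \<open>polar_speed\<close> is the angular velocity at the point with
  polar coordinates \<open>r\<close>, \<open>\<theta>\<close>, and \<open>polar_energy\<close> is the Hamiltonian, normalised to be zero at the
  origin. Both are polynomials in \<open>r\<close> whose coefficients depend on the angle through \<open>D\<close>. The
  exponent \<open>2 * k - 1\<close> is meant for \<open>k \<ge> 1\<close>.
\<close>

definition polar_speed :: "nat \<Rightarrow> (nat \<Rightarrow> real \<Rightarrow> real) \<Rightarrow> real \<Rightarrow> real \<Rightarrow> real" where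
  "polar_speed n D r \<theta> = 1 + (\<Sum>k=1..n. D k \<theta> * r ^ (2 * k - 1))"

definition polar_energy :: "nat \<Rightarrow> (nat \<Rightarrow> real \<Rightarrow> real) \<Rightarrow> real \<Rightarrow> real \<Rightarrow> real" where
  "polar_energy n D r \<theta> = r\<^sup>2 / 2 + (\<Sum>k=1..n. D k \<theta> * r ^ (2 * k + 1) / (2 * k + 1))"

lemma polar_energy_deriv:
  "((\<lambda>r. polar_energy n D r \<theta>) has_real_derivative r * polar_speed n D r \<theta>) (at r)"
proof -
  have "((\<lambda>r. D k \<theta> * r ^ (2 * k + 1) / (2 * k + 1)) has_real_derivative
      r * (D k \<theta> * r ^ (2 * k - 1))) (at r)" if "k \<in> {1..n}" for k
  proof -
    have "r * r ^ (2 * k - 1) = r ^ (2 * k)"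
      using that by (metis One_nat_def atLeastAtMost_iff mult_pos_pos not_gr0 not_one_le_zero pos2 power_minus_mult mult.commute)
    then have eq: "r * (D k \<theta> * r ^ (2 * k - 1)) = D k \<theta> * r ^ (2 * k)"
      by (metis mult.left_commute)
    have "((\<lambda>r. D k \<theta> * r ^ (2 * k + 1) / (2 * k + 1)) has_real_derivative D k \<theta> * r ^ (2 * k)) (at r)"
      using DERIV_cdivide[OF DERIV_cmult[OF DERIV_pow[of "2 * k + 1" r UNIV]], of "D k \<theta>" "2 * k + 1"]
      by (simp del: power_Suc)
    then show ?thesis
      by (simp only: eq)
  qed
  then have "((\<lambda>r. \<Sum>k=1..n. D k \<theta> * r ^ (2 * k + 1) / (2 * k + 1)) has_real_derivative
      (\<Sum>k=1..n. r * (D k \<theta> * r ^ (2 * k - 1)))) (at r)"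
    by (rule DERIV_sum)
  moreover have "((\<lambda>r. r\<^sup>2 / 2) has_real_derivative r) (at r)"
    by (auto intro!: derivative_eq_intros)
  ultimately show ?thesis
    unfolding polar_energy_def polar_speed_def distrib_left sum_distrib_left mult_1_right
    by (rule DERIV_add[rotated])
qed

text \<open>
  On the disc of radius \<open>R\<close> the nonlinear terms change the angular velocity and the energy by at
  most a factor between 1/2 and 3/2, so the motion turns in one direction and the energy increases along rays. The condition
  \<open>D_antiperiodic\<close> is what the even degree of the nonlinear terms of the field amounts to.
\<close>

locale small_disc =
  fixes n :: nat and D :: "nat \<Rightarrow> real \<Rightarrow> real" and B R :: real
  assumes D_cont: "\<And>k. continuous_on UNIV (D k)"
    and D_bound: "\<And>k \<theta>. k \<in> {1..n} \<Longrightarrow> \<bar>D k \<theta>\<bar> \<le> B"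
    and D_antiperiodic: "\<And>k \<theta>. D k (\<theta> + pi) = - D k \<theta>"
    and B_nonneg: "0 \<le> B"
    and R: "0 < R" "R \<le> 1" "n * B * R \<le> 1 / 4"
begin

abbreviation "speed \<equiv> polar_speed n D"
abbreviation "energy \<equiv> polar_energy n D"

lemma D_periodic: "D k (\<theta> + 2 * pi) = D k \<theta>"
  using D_antiperiodic[of k \<theta>] D_antiperiodic[of k "\<theta> + pi"] by (simp add: add.assoc)

lemma isCont_D: "isCont (D k) \<theta>"
  using D_cont by (simp add: continuous_on_eq_continuous_at)

text \<open>
  The one estimate behind all bounds on the disc. The weights \<open>c\<close> allow the same bound for the
  speed, where they are 1, and for the energy, where they are \<open>1 / (2 * k + 1)\<close>.
\<close>

lemma sum_D_bound:
  assumes "0 \<le> r" "r \<le> 1" "\<And>k. k \<in> A \<Longrightarrow> m \<le> e k" "A \<subseteq> {1..n}" "\<And>k. 0 \<le> c k \<and> c k \<le> 1"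
  shows "\<bar>\<Sum>k\<in>A. c k * (D k \<theta> * r ^ e k)\<bar> \<le> n * B * r ^ m"
proof -
  have "\<bar>c k * (D k \<theta> * r ^ e k)\<bar> \<le> B * r ^ m" if "k \<in> A" for k
  proof -
    have "\<bar>D k \<theta>\<bar> * r ^ e k \<le> B * r ^ m"
      using assms that D_bound[of k] B_nonneg by (intro mult_mono power_decreasing) auto
    moreover have "0 \<le> \<bar>D k \<theta>\<bar> * r ^ e k"
      using assms by simp
    ultimately show ?thesis
      using assms(5)[of k] mult_left_le_one_le[of "\<bar>D k \<theta>\<bar> * r ^ e k" "c k"] assms(1)
      by (simp add: abs_mult)
  qed
  then have "\<bar>\<Sum>k\<in>A. c k * (D k \<theta> * r ^ e k)\<bar> \<le> (\<Sum>k\<in>A. B * r ^ m)"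
    by (intro order_trans[OF sum_abs] sum_mono)
  also have "\<dots> = card A * (B * r ^ m)"
    by simp
  also have "\<dots> \<le> n * (B * r ^ m)"
    using assms B_nonneg card_mono[OF _ assms(4)] by (intro mult_right_mono) auto
  finally show ?thesis
    by (simp add: mult.assoc)
qed

lemma speed_near_1:
  assumes "0 \<le> r" "r \<le> R"
  shows "\<bar>speed r \<theta> - 1\<bar> \<le> n * B * r" "3 / 4 \<le> speed r \<theta>" "speed r \<theta> \<le> 5 / 4"
proof -
  have "\<bar>\<Sum>k=1..n. 1 * (D k \<theta> * r ^ (2 * k - 1))\<bar> \<le> n * B * r ^ 1"
    using assms R by (intro sum_D_bound) auto
  then show "\<bar>speed r \<theta> - 1\<bar> \<le> n * B * r"
    by (simp add: polar_speed_def)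
  also have "n * B * r \<le> n * B * R"
    using assms B_nonneg by (intro mult_left_mono) auto
  finally have "\<bar>speed r \<theta> - 1\<bar> \<le> 1 / 4"
    using R by linarith
  then show "3 / 4 \<le> speed r \<theta>" "speed r \<theta> \<le> 5 / 4"
    unfolding abs_le_iff by linarith+
qed

text \<open>
  The relative deviation of the energy from that of the harmonic oscillator.
\<close>

definition defect :: "real \<Rightarrow> real \<Rightarrow> real" where
  "defect r \<theta> = (\<Sum>k=1..n. 1 / (2 * k + 1) * (D k \<theta> * r ^ (2 * k - 1)))"

lemma energy_defect: "2 * energy r \<theta> = r\<^sup>2 * (1 + 2 * defect r \<theta>)"
proof -
  have "D k \<theta> * r ^ (2 * k + 1) / (2 * k + 1) = r\<^sup>2 * (1 / (2 * k + 1) * (D k \<theta> * r ^ (2 * k - 1)))"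
    if "k \<in> {1..n}" for k
  proof -
    have "r ^ (2 * k + 1) = r\<^sup>2 * r ^ (2 * k - 1)"
      using that by (simp flip: power_add)
    then show ?thesis
      by simp
  qed
  then have "energy r \<theta> = r\<^sup>2 / 2 + r\<^sup>2 * defect r \<theta>"
    unfolding polar_energy_def defect_def sum_distrib_left by (intro arg_cong2[where f="(+)"] sum.cong) auto
  then show ?thesis
    by (simp add: algebra_simps)
qed

lemma defect_small:
  assumes "0 \<le> r" "r \<le> R"
  shows "\<bar>defect r \<theta>\<bar> \<le> 1 / 4"
proof -
  have "\<bar>defect r \<theta>\<bar> \<le> n * B * r ^ 1"
    unfolding defect_def using assms R by (intro sum_D_bound) auto
  also have "n * B * r ^ 1 \<le> n * B * R"
    using assms B_nonneg by (simp add: mult_left_mono)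
  finally show ?thesis
    using R by linarith
qed

lemma energy_strict_mono:
  assumes "0 \<le> x" "x < y" "y \<le> R"
  shows "energy x \<theta> < energy y \<theta>"
proof (rule DERIV_pos_imp_increasing_open[OF \<open>x < y\<close>])
  fix z assume "x < z" "z < y"
  then have "0 < z * speed z \<theta>"
    using assms speed_near_1(2)[of z \<theta>] by (intro mult_pos_pos) auto
  then show "\<exists>d. ((\<lambda>r. energy r \<theta>) has_real_derivative d) (at z) \<and> 0 < d"
    using polar_energy_deriv[of n D \<theta> z] by auto
next
  show "continuous_on {x..y} (\<lambda>r. energy r \<theta>)"
    by (intro continuous_at_imp_continuous_on ballI DERIV_isCont[OF polar_energy_deriv])
qed

text \<open>
  The level curve of the energy is labelled by \<open>s\<close>, the radius that it would have for the harmonic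
  oscillator.
\<close>

definition radius :: "real \<Rightarrow> real \<Rightarrow> real" where
  "radius s \<theta> = (THE r. 0 < r \<and> r < R \<and> 2 * energy r \<theta> = s\<^sup>2)"

lemma radius_spec:
  assumes "0 < s" "s \<le> R / 2"
  shows "0 < radius s \<theta> \<and> radius s \<theta> < R \<and> 2 * energy (radius s \<theta>) \<theta> = s\<^sup>2"
  unfolding radius_def
proof (rule theI')
  have "s\<^sup>2 \<le> (R / 2)\<^sup>2"
    using assms by (intro power_mono) auto
  also have "\<dots> < R\<^sup>2 * (1 / 2)"
    using R by (simp add: power2_eq_square)
  also have "\<dots> \<le> R\<^sup>2 * (1 + 2 * defect R \<theta>)"
    using defect_small[of R \<theta>] R by (intro mult_left_mono) auto
  finally have boundary: "s\<^sup>2 < 2 * energy R \<theta>"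
    by (simp add: energy_defect)
  have "\<exists>r\<ge>0. r \<le> R \<and> energy r \<theta> = s\<^sup>2 / 2"
  proof (rule IVT)
    show "energy 0 \<theta> \<le> s\<^sup>2 / 2"
      using energy_defect[of 0 \<theta>] by simp
    show "s\<^sup>2 / 2 \<le> energy R \<theta>"
      using boundary by simp
    show "\<forall>r. 0 \<le> r \<and> r \<le> R \<longrightarrow> isCont (\<lambda>r. energy r \<theta>) r"
      by (intro allI impI DERIV_isCont[OF polar_energy_deriv])
  qed (use R in auto)
  then obtain r where r: "0 \<le> r" "r \<le> R" "2 * energy r \<theta> = s\<^sup>2"
    by auto
  have "r \<noteq> 0"
    using r assms energy_defect[of 0 \<theta>] by auto
  moreover have "r \<noteq> R"
    using r boundary by auto
  ultimately have r': "0 < r \<and> r < R \<and> 2 * energy r \<theta> = s\<^sup>2"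
    using r by auto
  show "\<exists>!r. 0 < r \<and> r < R \<and> 2 * energy r \<theta> = s\<^sup>2"
  proof (rule ex1I, rule r')
    fix x assume x: "0 < x \<and> x < R \<and> 2 * energy x \<theta> = s\<^sup>2"
    show "x = r"
      using energy_strict_mono[of x r \<theta>] energy_strict_mono[of r x \<theta>] x r'
      by (cases x r rule: linorder_cases) auto
  qed
qed

lemma radius_bounds:
  assumes "0 < s" "s \<le> R / 2"
  shows "s / 2 \<le> radius s \<theta>" "radius s \<theta> \<le> 2 * s"
proof -
  define r where "r = radius s \<theta>"
  have r: "0 < r" "r < R" "s\<^sup>2 = r\<^sup>2 * (1 + 2 * defect r \<theta>)"
    using radius_spec[OF assms, of \<theta>] by (auto simp: r_def energy_defect)
  have "\<bar>defect r \<theta>\<bar> \<le> 1 / 4"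
    using r by (intro defect_small) auto
  then have "r\<^sup>2 * (1 / 4) \<le> s\<^sup>2" "s\<^sup>2 \<le> r\<^sup>2 * 4"
    unfolding r(3) by (intro mult_left_mono; auto)+
  then have "(r / 2)\<^sup>2 \<le> s\<^sup>2" "s\<^sup>2 \<le> (2 * r)\<^sup>2"
    by (auto simp: power2_eq_square)
  then have "r / 2 \<le> s" "s \<le> 2 * r"
    using power2_le_imp_le[of "r / 2" s] power2_le_imp_le[of s "2 * r"] r(1) assms by auto
  then show "s / 2 \<le> radius s \<theta>" "radius s \<theta> \<le> 2 * s"
    by (auto simp: r_def)
qed

lemma radius_periodic: "radius s (\<theta> + 2 * pi) = radius s \<theta>"
  by (simp add: radius_def polar_energy_def D_periodic)

lemma isCont_energy: "isCont (energy r) \<theta>"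
  unfolding polar_energy_def[abs_def] by (intro continuous_intros isCont_D) auto

lemma isCont_speed: "isCont \<xi> \<theta> \<Longrightarrow> isCont (\<lambda>\<phi>. speed (\<xi> \<phi>) \<phi>) \<theta>"
  unfolding polar_speed_def[abs_def] by (intro continuous_intros isCont_D) auto

lemma isCont_radius:
  assumes "0 < s" "s \<le> R / 2"
  shows "isCont (radius s) \<theta>"
  by (rule implicit_root_isCont[of 0 R energy _ _ "s\<^sup>2 / 2"])
    (use energy_strict_mono isCont_energy radius_spec[OF assms] in \<open>auto simp: field_simps\<close>)

lemma radius_deriv:
  assumes "0 < s" "s \<le> R / 2"
    and "(energy (radius s \<theta>) has_real_derivative d) (at \<theta>)"
  shows "(radius s has_real_derivative - d / (radius s \<theta> * speed (radius s \<theta>) \<theta>)) (at \<theta>)"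
proof (rule implicit_root_DERIV[where F=energy and a=0 and b=R and w="s\<^sup>2 / 2"
      and F'="\<lambda>r \<theta>. r * speed r \<theta>"])
  show "0 < x * speed x \<phi>" if "0 < x" "x < R" for x \<phi>
    using that speed_near_1(2)[of x \<phi>] by (intro mult_pos_pos) auto
  show "isCont (\<lambda>\<phi>. \<xi> \<phi> * speed (\<xi> \<phi>) \<phi>) \<theta>" if "isCont \<xi> \<theta>" for \<xi>
    using that by (intro continuous_intros isCont_speed)
  show "0 < radius s \<phi> \<and> radius s \<phi> < R \<and> energy (radius s \<phi>) \<phi> = s\<^sup>2 / 2" for \<phi>
    using radius_spec[OF assms(1,2), of \<phi>] by auto
qed (use assms isCont_energy polar_energy_deriv in auto)

definition period :: "real \<Rightarrow> real" where
  "period s = integral {0..2 * pi} (\<lambda>\<theta>. 1 / speed (radius s \<theta>) \<theta>)"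

lemma continuous_on_inverse_speed:
  assumes "0 < s" "s \<le> R / 2"
  shows "continuous_on S (\<lambda>\<theta>. 1 / speed (radius s \<theta>) \<theta>)"
proof (intro continuous_at_imp_continuous_on ballI continuous_intros isCont_speed isCont_radius[OF assms])
  show "speed (radius s \<theta>) \<theta> \<noteq> 0" for \<theta>
    using speed_near_1(2)[of "radius s \<theta>" \<theta>] radius_spec[OF assms, of \<theta>] by auto
qed

text \<open>
  The level curve labelled \<open>s\<close> is turned into a solution by running through it with the angular
  velocity that the field prescribes. That the radial velocity is then correct too is conservation
  of energy: the slope of the level curve is minus the quotient of the partial derivatives of the
  energy, which up to a factor are the radial and the angular component of the field.
\<close>

lemma level_curve_periodic_orbit:
  assumes s: "0 < s" "s \<le> R / 2"
    and radial: "\<And>r \<theta>. \<lbrakk>0 < r; r < R\<rbrakk> \<Longrightarrow> Im (cis (- \<theta>) * X (r * cis \<theta>)) = r * speed r \<theta>"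
    and tangential: "\<And>r \<theta>. \<lbrakk>0 < r; r < R\<rbrakk> \<Longrightarrow>
      (energy r has_real_derivative - r * Re (cis (- \<theta>) * X (r * cis \<theta>))) (at \<theta>)"
  shows "\<exists>\<gamma>. periodic_orbit X \<gamma> (period s) \<and> (\<forall>t. norm (\<gamma> t) \<le> 2 * s)"
proof -
  let ?v = "\<lambda>\<theta>. speed (radius s \<theta>) \<theta>"
  have rad: "0 < radius s \<theta>" "radius s \<theta> < R" for \<theta>
    using radius_spec[OF s] by auto
  have v: "3 / 4 \<le> ?v \<theta>" "?v \<theta> \<le> 5 / 4" for \<theta>
    using speed_near_1(2,3)[of "radius s \<theta>" \<theta>] rad[of \<theta>] by auto
  have v_pos: "0 < ?v \<theta>" for \<theta>
    using v(1)[of \<theta>] by linarith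
  have lower: "4 / 5 \<le> 1 / ?v \<theta>" for \<theta>
    using v(2)[of \<theta>] v_pos[of \<theta>] by (simp add: field_simps)
  have v_periodic: "?v (\<theta> + 2 * pi) = ?v \<theta>" for \<theta>
    by (simp only: radius_periodic) (simp add: polar_speed_def D_periodic)
  obtain \<Theta> where \<Theta>: "\<And>t. (\<Theta> has_real_derivative ?v (\<Theta> t)) (at t)" "strict_mono \<Theta>" "\<Theta> 0 = 0"
      "\<And>t. \<Theta> (t + period s) = \<Theta> t + 2 * pi"
    using time_change[of "\<lambda>\<theta>. 1 / ?v \<theta>" "4 / 5" "2 * pi"] continuous_on_inverse_speed[OF s, of UNIV]
      lower v_periodic
    unfolding period_def by (auto simp del: One_nat_def)
  define \<gamma> where "\<gamma> t = radius s (\<Theta> t) * cis (\<Theta> t)" for t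
  \<comment> \<open>With \<open>Y\<close> the field in the rotating frame, \<open>Re Y\<close> is the radial velocity and \<open>Im Y\<close> is the radius times the angular velocity.\<close>
  have "(\<gamma> has_vector_derivative X (\<gamma> t)) (at t)" for t
  proof -
    define \<theta> where "\<theta> = \<Theta> t"
    define r where "r = radius s \<theta>"
    define Y where "Y = cis (- \<theta>) * X (r * cis \<theta>)"
    have r: "0 < r" "r < R"
      using rad by (auto simp: r_def)
    have ImY: "Im Y = r * speed r \<theta>"
      using radial r unfolding Y_def by blast
    have speed_pos: "0 < speed r \<theta>"
      using v_pos by (simp add: r_def)
    have XY: "X (r * cis \<theta>) = Y * cis \<theta>"
      by (simp add: Y_def mult.commute mult.left_commute cis_mult flip: mult.assoc)
    have d\<Theta>: "(\<Theta> has_vector_derivative speed r \<theta>) (at t)"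
      using \<Theta>(1)[of t] by (simp add: \<theta>_def r_def has_real_derivative_iff_has_vector_derivative)
    have "(radius s has_real_derivative r * Re Y / (r * speed r \<theta>)) (at \<theta>)"
      using radius_deriv[OF s tangential[OF rad]] by (simp add: r_def Y_def)
    then have "(radius s has_real_derivative Re Y / speed r \<theta>) (at \<theta>)"
      using r by simp
    from DERIV_chain2[OF this[unfolded \<theta>_def] \<Theta>(1)]
    have "((\<lambda>t. radius s (\<Theta> t)) has_real_derivative Re Y) (at t)"
      using speed_pos by (simp add: \<theta>_def r_def)
    then have d\<rho>: "((\<lambda>t. complex_of_real (radius s (\<Theta> t))) has_vector_derivative Re Y) (at t)"
      by (simp add: has_real_derivative_iff_has_vector_derivative has_vector_derivative_of_real)
    have "((\<lambda>t. cis (\<Theta> t)) has_vector_derivative \<i> * speed r \<theta> * cis \<theta>) (at t)"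
    proof -
      have "((\<lambda>t. cos (\<Theta> t)) has_real_derivative - sin \<theta> * speed r \<theta>) (at t)"
        "((\<lambda>t. sin (\<Theta> t)) has_real_derivative cos \<theta> * speed r \<theta>) (at t)"
        using \<Theta>(1)[of t] by (auto intro!: derivative_eq_intros simp: \<theta>_def r_def)
      then show ?thesis
        by (simp add: has_vector_derivative_complex_iff has_real_derivative_iff_has_vector_derivative mult.commute)
    qed
    from has_vector_derivative_mult[OF d\<rho> this]
    have "(\<gamma> has_vector_derivative r * (\<i> * speed r \<theta> * cis \<theta>) + Re Y * cis \<theta>) (at t)"
      unfolding \<gamma>_def[abs_def] by (simp add: r_def \<theta>_def)
    also have "r * (\<i> * speed r \<theta> * cis \<theta>) + Re Y * cis \<theta> = Complex (Re Y) (Im Y) * cis \<theta>"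
      unfolding ImY Complex_eq by (simp add: algebra_simps)
    also have "\<dots> = X (\<gamma> t)"
      using XY by (simp add: \<gamma>_def r_def \<theta>_def)
    finally show ?thesis .
  qed
  moreover have "\<gamma> (t + period s) = \<gamma> t" for t
    by (simp only: \<gamma>_def \<Theta>(4) radius_periodic) (simp flip: cis_mult)
  moreover have "\<exists>t. \<gamma> (t + S) \<noteq> \<gamma> t" if "0 < S" "S < period s" for S
  proof -
    have "0 < \<Theta> S" "\<Theta> S < 2 * pi"
      using strict_monoD[OF \<Theta>(2), of 0 S] strict_monoD[OF \<Theta>(2), of S "period s"] that \<Theta>(3) \<Theta>(4)[of 0]
      by auto
    \<comment> \<open>Before time \<open>period s\<close> the angle is strictly between \<open>0\<close> and \<open>2 * pi\<close>.\<close>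
    have "\<gamma> S \<noteq> \<gamma> 0"
    proof
      assume eq: "\<gamma> S = \<gamma> 0"
      then have "norm (\<gamma> S) = norm (\<gamma> 0)"
        by simp
      then have "radius s (\<Theta> S) = radius s 0"
        using rad[of "\<Theta> S"] rad[of 0] by (simp add: \<gamma>_def \<Theta>(3) norm_mult)
      then have "cis (\<Theta> S) = 1"
        using eq rad[of 0] by (simp add: \<gamma>_def \<Theta>(3))
      then have "cos (\<Theta> S) = 1"
        by (metis cis.simps(1) one_complex.simps(1))
      then show False
        using cos_one_2pi_int[of "\<Theta> S"] \<open>0 < \<Theta> S\<close> \<open>\<Theta> S < 2 * pi\<close>
        by (auto simp: zero_less_mult_iff)
    qed
    then show ?thesis
      by (intro exI[of _ 0]) simp
  qed
  moreover have "0 < period s"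
  proof (rule ccontr)
    assume "\<not> 0 < period s"
    then have "\<Theta> (period s) \<le> \<Theta> 0"
      by (intro strict_mono_leD[OF \<Theta>(2)]) auto
    then show False
      using \<Theta>(4)[of 0] pi_gt_zero by auto
  qed
  moreover have "norm (\<gamma> t) \<le> 2 * s" for t
    using radius_bounds(2)[OF s, of "\<Theta> t"] rad[of "\<Theta> t"] by (simp add: \<gamma>_def norm_mult)
  ultimately show ?thesis
    unfolding periodic_orbit_def by blast
qed

end

section \<open>The period near the origin\<close>

text \<open>
  For an antiderivative \<open>F\<close>, antiperiodicity of \<open>f\<close> makes \<open>F (x + L) + F x\<close> constant; compare the
  values at \<open>0\<close> and at \<open>L\<close>.
\<close>

lemma integral_antiperiodic:
  fixes f :: "real \<Rightarrow> real"
  assumes "continuous_on UNIV f" "0 \<le> L" and anti: "\<And>x. f (x + L) = - f x"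
  shows "integral {0..2 * L} f = 0"
proof -
  have "isCont f x" for x
    using assms(1) by (simp add: continuous_on_eq_continuous_at)
  then obtain F where F: "\<And>x::real. (F has_vector_derivative f x) (at x)"
    using einterval_antiderivative[of "-\<infinity>" "\<infinity>" f] by auto
  then have F': "(F has_real_derivative f x) (at x)" for x
    by (simp add: has_real_derivative_iff_has_vector_derivative)
  have "((\<lambda>x. F (x + L) + F x) has_real_derivative 0) (at x)" for x
    using DERIV_add[OF DERIV_shift[THEN iffD1, OF F'[of "x + L"]] F'[of x]] by (simp add: anti)
  then have "F (L + L) + F L = F (0 + L) + F 0"
    by (intro DERIV_isconst_all[of "\<lambda>x. F (x + L) + F x"]) auto
  then have "F (2 * L) = F 0"
    by (simp flip: mult_2)
  moreover have "(f has_integral F (2 * L) - F 0) {0..2 * L}"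
    using F \<open>0 \<le> L\<close>
    by (intro fundamental_theorem_of_calculus) (auto intro: has_vector_derivative_at_within)
  ultimately have "(f has_integral 0) {0..2 * L}"
    by simp
  then show ?thesis
    by (rule integral_unique)
qed

lemma power_quotient_le:
  fixes x y :: real
  assumes "0 \<le> x" "x \<le> M" "0 \<le> y" "y \<le> M"
  shows "(\<Sum>i<j. y ^ (j - Suc i) * x ^ i) \<le> j * M ^ (j - 1)"
proof -
  have "y ^ (j - Suc i) * x ^ i \<le> M ^ (j - 1)" if "i < j" for i
  proof -
    have "y ^ (j - Suc i) * x ^ i \<le> M ^ (j - Suc i) * M ^ i"
      using assms by (intro mult_mono power_mono) auto
    also have "\<dots> = M ^ (j - 1)"
      using that by (simp flip: power_add)
    finally show ?thesis .
  qed
  then have "(\<Sum>i<j. y ^ (j - Suc i) * x ^ i) \<le> (\<Sum>i<j. M ^ (j - 1))"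
    by (intro sum_mono) auto
  then show ?thesis
    by simp
qed

lemma power_diff_abs_le:
  fixes x y :: real
  assumes "0 \<le> x" "x \<le> M" "0 \<le> y" "y \<le> M"
  shows "\<bar>x ^ j - y ^ j\<bar> \<le> \<bar>x - y\<bar> * (j * M ^ (j - 1))"
proof -
  have "0 \<le> (\<Sum>i<j. y ^ (j - Suc i) * x ^ i)"
    using assms by (intro sum_nonneg) auto
  then show ?thesis
    using power_quotient_le[OF assms, of j] by (simp add: power_diff_sumr2[of x j y] abs_mult mult_left_mono)
qed

context small_disc
begin

lemma sum_leading:
  fixes f :: "nat \<Rightarrow> real"
  assumes "a \<in> {1..n}" "\<And>k. \<lbrakk>1 \<le> k; k < a\<rbrakk> \<Longrightarrow> f k = 0"
  shows "(\<Sum>k=1..n. f k) = f a + (\<Sum>k=a+1..n. f k)"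
proof -
  have "(\<Sum>k=1..n. f k) = (\<Sum>k=a..n. f k)"
    using assms by (intro sum.mono_neutral_right) auto
  then show ?thesis
    using assms by (simp add: sum.atLeast_Suc_atMost)
qed

text \<open>
  The speed along the level curve is expanded in powers of \<open>s\<close>. Replacing the radius \<open>r\<close> by \<open>s\<close> in
  every term gives the linear part, the sum on the right. The correction in the lowest term
  \<open>h * r ^ m\<close>, where \<open>h = D a \<theta>\<close>, has a sign. Up to higher order:
  where \<open>h\<close> is positive, the energy exceeds that of the harmonic oscillator, so the level curve runs inside the circle of radius \<open>s\<close> and \<open>r ^ m < s ^ m\<close>;
  where \<open>h\<close> is negative, it runs outside. In both cases \<open>h * (s ^ m - r ^ m)\<close> is a positive multiple of
  \<open>h\<^sup>2 * s ^ (2 * m)\<close>. The corrections in the other terms have higher order. Explicit constants make the estimate uniform in the angle.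
\<close>

lemma speed_expansion:
  assumes s: "0 < s" "s \<le> R / 2"
    and a: "a \<in> {1..n}" and vanish: "\<And>k. \<lbrakk>1 \<le> k; k < a\<rbrakk> \<Longrightarrow> D k \<theta> = 0"
    and m: "m = 2 * a - 1"
  shows "speed (radius s \<theta>) \<theta> \<le> 1 + (\<Sum>k=1..n. D k \<theta> * s ^ (2 * k - 1))
     - 2 / (3 * (2 * real a + 1)) * (s / 2) ^ (2 * m) * (D a \<theta>)\<^sup>2
     + 4 * (real n)\<^sup>2 * (real n + 1) * B\<^sup>2 * (2 * s) ^ (2 * m + 1)"
proof -
  define r where "r = radius s \<theta>"
  define h where "h = D a \<theta>"
  define G where "G = defect r \<theta>"
  define E where "E = (\<Sum>k=a+1..n. 1 / (2 * k + 1) * (D k \<theta> * r ^ (2 * k - 1)))"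
  have r: "0 < r" "r < R" "s\<^sup>2 = r\<^sup>2 * (1 + 2 * G)" "s / 2 \<le> r" "r \<le> 2 * s"
    using radius_spec[OF s, of \<theta>] radius_bounds[OF s, of \<theta>] by (auto simp: r_def G_def energy_defect)
  have r1: "r \<le> 1" and s1: "2 * s \<le> 1"
    using r R s by auto
  have m1: "1 \<le> m" "m \<le> 2 * n"
    using a m by auto
  have h_bound: "\<bar>h\<bar> \<le> B"
    using D_bound a by (simp add: h_def)
  have G_split: "G = h * r ^ m / (2 * a + 1) + E"
    unfolding G_def E_def defect_def m h_def using a vanish by (subst sum_leading[of a]) auto
  have "\<bar>\<Sum>k=a..n. 1 / (2 * k + 1) * (D k \<theta> * r ^ (2 * k - 1))\<bar> \<le> n * B * r ^ m"
    using r r1 a m by (intro sum_D_bound) auto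
  moreover have "(\<Sum>k=1..n. 1 / (2 * k + 1) * (D k \<theta> * r ^ (2 * k - 1)))
      = (\<Sum>k=a..n. 1 / (2 * k + 1) * (D k \<theta> * r ^ (2 * k - 1)))"
    using a vanish by (intro sum.mono_neutral_right) auto
  ultimately have "\<bar>G\<bar> \<le> n * B * r ^ m"
    by (simp add: G_def defect_def)
  also have "\<dots> \<le> n * B * (2 * s) ^ m"
    using r B_nonneg by (intro mult_left_mono power_mono) auto
  finally have G_bound: "\<bar>G\<bar> \<le> n * B * (2 * s) ^ m" .
  have "\<bar>E\<bar> \<le> n * B * r ^ (m + 1)"
    unfolding E_def using r r1 m by (intro sum_D_bound) auto
  also have "\<dots> \<le> n * B * (2 * s) ^ (m + 1)"
    using r B_nonneg by (intro mult_left_mono power_mono) auto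
  finally have E_bound: "\<bar>E\<bar> \<le> n * B * (2 * s) ^ (m + 1)" .
  \<comment> \<open>The energy equation \<open>s\<^sup>2 = r\<^sup>2 * (1 + 2 * G)\<close>, solved for the difference of the radii.\<close>
  have sr: "s - r = 2 * r\<^sup>2 / (s + r) * G"
  proof -
    have "(s - r) * (s + r) = 2 * r\<^sup>2 * G"
      using r(3) by (simp add: algebra_simps power2_eq_square)
    then show ?thesis
      using r s by (simp add: field_simps)
  qed
  have q_upper: "2 * r\<^sup>2 / (s + r) \<le> 2 * (2 * s)" and q_lower: "2 / 3 * r \<le> 2 * r\<^sup>2 / (s + r)"
  proof -
    have "2 * r\<^sup>2 / (s + r) \<le> 2 * r"
      using r s by (simp add: field_simps power2_eq_square)
    then show "2 * r\<^sup>2 / (s + r) \<le> 2 * (2 * s)"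
      using r by linarith
    have "s * r \<le> 2 * r * r"
      using r by (intro mult_right_mono) auto
    then show "2 / 3 * r \<le> 2 * r\<^sup>2 / (s + r)"
      using r s by (simp add: field_simps power2_eq_square)
  qed
  have q_nonneg: "0 \<le> 2 * r\<^sup>2 / (s + r)"
    using r s by simp
  have "\<bar>s - r\<bar> \<le> 2 * (2 * s) * (n * B * (2 * s) ^ m)"
    unfolding sr abs_mult abs_of_nonneg[OF q_nonneg] using q_upper G_bound s by (intro mult_mono) auto
  then have sr_bound: "\<bar>s - r\<bar> \<le> 2 * real n * B * (2 * s) ^ (m + 1)"
    by (simp add: algebra_simps)
  have pw: "(2 * s) ^ (2 * m + 1) = (2 * s) ^ m * (2 * s) ^ (m + 1)"
    using power_add[of "2 * s" m "m + 1"] by (simp add: mult_2[symmetric] del: power_Suc)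
  \<comment> \<open>A factor of order \<open>m + 1\<close> comes from \<open>s - r\<close>; the remaining \<open>2 * k - 2\<close> powers are at least \<open>m\<close>, as \<open>k > a\<close>.\<close>
  have higher: "D k \<theta> * (r ^ (2 * k - 1) - s ^ (2 * k - 1)) \<le> 4 * (real n)\<^sup>2 * B\<^sup>2 * (2 * s) ^ (2 * m + 1)"
    if k: "k \<in> {a+1..n}" for k
  proof -
    have "\<bar>s ^ (2 * k - 1) - r ^ (2 * k - 1)\<bar> \<le> \<bar>s - r\<bar> * (real (2 * k - 1) * (2 * s) ^ (2 * k - 1 - 1))"
      using s r by (intro power_diff_abs_le) auto
    also have "\<dots> \<le> (2 * real n * B * (2 * s) ^ (m + 1)) * (2 * real n * (2 * s) ^ m)"
    proof (intro mult_mono sr_bound power_decreasing)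
      show "real (2 * k - 1) \<le> 2 * real n"
        using k by auto
      show "m \<le> 2 * k - 1 - 1"
        using k m by auto
    qed (use s s1 B_nonneg in auto)
    finally have "\<bar>s ^ (2 * k - 1) - r ^ (2 * k - 1)\<bar> \<le> 4 * (real n)\<^sup>2 * B * (2 * s) ^ (2 * m + 1)"
      unfolding pw by (simp add: power2_eq_square mult.commute mult.left_commute)
    then have "\<bar>D k \<theta>\<bar> * \<bar>s ^ (2 * k - 1) - r ^ (2 * k - 1)\<bar> \<le> B * (4 * (real n)\<^sup>2 * B * (2 * s) ^ (2 * m + 1))"
      using D_bound[of k \<theta>] k B_nonneg by (intro mult_mono) auto
    moreover have "D k \<theta> * (r ^ (2 * k - 1) - s ^ (2 * k - 1)) \<le> \<bar>D k \<theta>\<bar> * \<bar>s ^ (2 * k - 1) - r ^ (2 * k - 1)\<bar>"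
      by (metis abs_ge_self abs_minus_commute abs_mult)
    ultimately show ?thesis
      by (simp add: power2_eq_square mult.commute mult.left_commute)
  qed
  \<comment> \<open>Then \<open>s ^ m - r ^ m = (s - r) * S = W * G\<close>, and \<open>W\<close> is nonnegative and of the exact order \<open>m\<close>.\<close>
  define S where "S = (\<Sum>i<m. r ^ (m - Suc i) * s ^ i)"
  define W where "W = 2 * r\<^sup>2 / (s + r) * S"
  have S_upper: "S \<le> m * (2 * s) ^ (m - 1)"
    unfolding S_def using r s by (intro power_quotient_le) auto
  have S_lower: "r ^ (m - 1) \<le> S"
    unfolding S_def using member_le_sum[of 0 "{..<m}" "\<lambda>i. r ^ (m - Suc i) * s ^ i"] m1 r s by simp
  have S_nonneg: "0 \<le> S"
    using S_lower r by (meson order_trans zero_le_power less_imp_le)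
  have W_upper: "W \<le> 2 * (2 * real n) * (2 * s) ^ m"
  proof -
    have "W \<le> (2 * (2 * s)) * (m * (2 * s) ^ (m - 1))"
      unfolding W_def using q_upper S_upper S_nonneg s by (intro mult_mono) auto
    also have "\<dots> = 2 * m * (2 * s) ^ m"
      using m1 by (cases m) auto
    also have "\<dots> \<le> 2 * (2 * real n) * (2 * s) ^ m"
      using m1 s by (intro mult_right_mono) auto
    finally show ?thesis .
  qed
  have W_lower: "2 / 3 * r ^ m \<le> W"
  proof -
    have "(2 / 3 * r) * r ^ (m - 1) \<le> W"
      unfolding W_def using q_lower S_lower S_nonneg q_nonneg r by (intro mult_mono) auto
    then show ?thesis
      using m1 by (cases m) auto
  qed
  have W_nonneg: "0 \<le> W"
    unfolding W_def by (rule mult_nonneg_nonneg[OF q_nonneg S_nonneg])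
  have "h * (s ^ m - r ^ m) = W * (h\<^sup>2 * r ^ m / (2 * a + 1)) + W * (h * E)"
    unfolding power_diff_sumr2[of s m r] sr W_def S_def G_split
    by (simp add: algebra_simps power2_eq_square)
  moreover have "2 / (3 * (2 * real a + 1)) * (s / 2) ^ (2 * m) * h\<^sup>2 \<le> W * (h\<^sup>2 * r ^ m / (2 * a + 1))"
  proof -
    have "(s / 2) ^ (2 * m) \<le> r ^ (2 * m)"
      using r s by (intro power_mono) auto
    also have "\<dots> = r ^ m * r ^ m"
      by (simp add: mult_2 power_add)
    finally have "2 / (3 * (2 * real a + 1)) * (s / 2) ^ (2 * m) * h\<^sup>2 \<le> 2 / (3 * (2 * real a + 1)) * (r ^ m * r ^ m) * h\<^sup>2"
      by (intro mult_right_mono mult_left_mono) auto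
    also have "\<dots> = (2 / 3 * r ^ m) * (h\<^sup>2 * r ^ m / (2 * a + 1))"
      by (simp add: algebra_simps)
    also have "\<dots> \<le> W * (h\<^sup>2 * r ^ m / (2 * a + 1))"
      using W_lower r by (intro mult_right_mono) auto
    finally show ?thesis .
  qed
  moreover have "- (4 * (real n)\<^sup>2 * B\<^sup>2 * (2 * s) ^ (2 * m + 1)) \<le> W * (h * E)"
  proof -
    have "\<bar>h * E\<bar> \<le> B * (n * B * (2 * s) ^ (m + 1))"
      unfolding abs_mult using h_bound E_bound B_nonneg by (intro mult_mono) auto
    then have "\<bar>W * (h * E)\<bar> \<le> (2 * (2 * real n) * (2 * s) ^ m) * (B * (n * B * (2 * s) ^ (m + 1)))"
      unfolding abs_mult[of W] using W_upper W_nonneg s by (intro mult_mono) auto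
    also have "\<dots> = 4 * (real n)\<^sup>2 * B\<^sup>2 * (2 * s) ^ (2 * m + 1)"
      unfolding pw by (simp add: power2_eq_square mult.commute mult.left_commute)
    finally show ?thesis
      by linarith
  qed
  moreover have "(\<Sum>k=a+1..n. D k \<theta> * (r ^ (2 * k - 1) - s ^ (2 * k - 1)))
      \<le> n * (4 * (real n)\<^sup>2 * B\<^sup>2 * (2 * s) ^ (2 * m + 1))"
  proof -
    have "(\<Sum>k=a+1..n. D k \<theta> * (r ^ (2 * k - 1) - s ^ (2 * k - 1)))
        \<le> (\<Sum>k=a+1..n. 4 * (real n)\<^sup>2 * B\<^sup>2 * (2 * s) ^ (2 * m + 1))"
      by (intro sum_mono higher)
    also have "\<dots> = (n - a) * (4 * (real n)\<^sup>2 * B\<^sup>2 * (2 * s) ^ (2 * m + 1))"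
      by simp
    also have "\<dots> \<le> n * (4 * (real n)\<^sup>2 * B\<^sup>2 * (2 * s) ^ (2 * m + 1))"
      using s by (intro mult_right_mono) auto
    finally show ?thesis .
  qed
  moreover have "speed r \<theta> - (1 + (\<Sum>k=1..n. D k \<theta> * s ^ (2 * k - 1)))
      = - (h * (s ^ m - r ^ m)) + (\<Sum>k=a+1..n. D k \<theta> * (r ^ (2 * k - 1) - s ^ (2 * k - 1)))"
  proof -
    have "speed r \<theta> - (1 + (\<Sum>k=1..n. D k \<theta> * s ^ (2 * k - 1)))
        = (\<Sum>k=1..n. D k \<theta> * (r ^ (2 * k - 1) - s ^ (2 * k - 1)))"
      by (simp add: polar_speed_def sum_subtractf right_diff_distrib)
    also have "\<dots> = D a \<theta> * (r ^ (2 * a - 1) - s ^ (2 * a - 1))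
        + (\<Sum>k=a+1..n. D k \<theta> * (r ^ (2 * k - 1) - s ^ (2 * k - 1)))"
      using a vanish by (intro sum_leading) auto
    finally show ?thesis
      by (simp add: h_def m algebra_simps)
  qed
  moreover have "4 * (real n)\<^sup>2 * (real n + 1) * B\<^sup>2 * (2 * s) ^ (2 * m + 1)
      = 4 * (real n)\<^sup>2 * B\<^sup>2 * (2 * s) ^ (2 * m + 1) + n * (4 * (real n)\<^sup>2 * B\<^sup>2 * (2 * s) ^ (2 * m + 1))"
    by (simp add: algebra_simps)
  ultimately show ?thesis
    unfolding r_def[symmetric] h_def[symmetric] by linarith
qed

lemma integrable_inverse_speed:
  assumes "0 < s" "s \<le> R / 2"
  shows "(\<lambda>\<theta>. 1 / speed (radius s \<theta>) \<theta>) integrable_on {0..2 * pi}"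
  using integrable_continuous_real[OF continuous_on_inverse_speed[OF assms]] .

lemma period_near_2pi:
  assumes s: "0 < s" "s \<le> R / 2"
  shows "\<bar>period s - 2 * pi\<bar> \<le> 16 * real n * B * pi * s"
proof -
  have "\<bar>1 / speed (radius s \<theta>) \<theta> - 1\<bar> \<le> 8 * real n * B * s" for \<theta>
  proof -
    define v where "v = speed (radius s \<theta>) \<theta>"
    have "0 < radius s \<theta>" "radius s \<theta> < R"
      using radius_spec[OF s] by auto
    then have v: "3 / 4 \<le> v" "\<bar>v - 1\<bar> \<le> n * B * radius s \<theta>"
      using speed_near_1[of "radius s \<theta>" \<theta>] by (auto simp: v_def)
    have "n * B * radius s \<theta> \<le> n * B * (2 * s)"
      using radius_bounds[OF s, of \<theta>] B_nonneg by (intro mult_left_mono) auto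
    then have "\<bar>v - 1\<bar> \<le> 2 * (n * B * s)"
      using v(2) by (simp add: mult.commute mult.left_commute)
    moreover have "\<bar>1 / v - 1\<bar> = \<bar>v - 1\<bar> / v"
    proof -
      have "1 / v - 1 = (1 - v) / v"
        using v(1) by (simp add: diff_divide_distrib)
      then show ?thesis
        using v(1) by (simp add: abs_divide abs_minus_commute)
    qed
    moreover have "\<bar>v - 1\<bar> / v \<le> \<bar>v - 1\<bar> / (1 / 4)"
      using v(1) by (intro divide_left_mono) auto
    ultimately show ?thesis
      by (simp add: v_def)
  qed
  moreover have "((\<lambda>\<theta>. 1 / speed (radius s \<theta>) \<theta> - 1) has_integral period s - 2 * pi) {0..2 * pi}"
    using has_integral_diff[OF integrable_integral[OF integrable_inverse_speed[OF s]]
        has_integral_const_real[of 1 0 "2 * pi"]]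
    by (simp add: period_def)
  ultimately have "norm (period s - 2 * pi) \<le> 8 * real n * B * s * measure lborel {0..2 * pi}"
    using B_nonneg s by (intro has_integral_bound_real) auto
  then show ?thesis
    by (simp add: mult.commute mult.left_commute)
qed

text \<open>
  By the tangent inequality \<open>1 / v \<ge> 2 - v\<close>, an upper bound on the speed bounds the period from
  below. The linear part of the expansion has mean zero by antiperiodicity.
\<close>

lemma period_lower_bound:
  assumes s: "0 < s" "s \<le> R / 2"
    and a: "a \<in> {1..n}" and vanish: "\<And>k \<theta>. \<lbrakk>1 \<le> k; k < a\<rbrakk> \<Longrightarrow> D k \<theta> = 0"
    and m: "m = 2 * a - 1"
  shows "2 * pi + 2 / (3 * (2 * real a + 1)) * (s / 2) ^ (2 * m) * integral {0..2 * pi} (\<lambda>\<theta>. (D a \<theta>)\<^sup>2)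
     - 4 * (real n)\<^sup>2 * (real n + 1) * B\<^sup>2 * (2 * s) ^ (2 * m + 1) * (2 * pi) \<le> period s"
proof -
  define c where "c = 2 / (3 * (2 * real a + 1)) * (s / 2) ^ (2 * m)"
  define e where "e = 4 * (real n)\<^sup>2 * (real n + 1) * B\<^sup>2 * (2 * s) ^ (2 * m + 1)"
  \<comment> \<open>\<open>g\<close> is \<open>2\<close> minus the upper bound of the speed.\<close>
  define g where "g \<theta> = 1 - e - (\<Sum>k=1..n. D k \<theta> * s ^ (2 * k - 1)) + c * (D a \<theta>)\<^sup>2" for \<theta>
  have contD: "continuous_on S (D k)" for S k
    using D_cont continuous_on_subset by blast
  have "(D k has_integral 0) {0..2 * pi}" for k
    using integral_antiperiodic[of "D k" pi] D_cont[of k] D_antiperiodic[of k]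
    by (auto intro!: has_integral_integrable_integral[THEN iffD2] integrable_continuous_real contD)
  then have "((\<lambda>\<theta>. \<Sum>k=1..n. D k \<theta> * s ^ (2 * k - 1)) has_integral (\<Sum>k=1..n. 0 * s ^ (2 * k - 1))) {0..2 * pi}"
    by (intro has_integral_sum has_integral_mult_left) auto
  moreover have "((\<lambda>\<theta>. 1 - e) has_integral 2 * pi * (1 - e)) {0..2 * pi}"
    using has_integral_const_real[of "1 - e" 0 "2 * pi"] by simp
  moreover have "((\<lambda>\<theta>. c * (D a \<theta>)\<^sup>2) has_integral c * integral {0..2 * pi} (\<lambda>\<theta>. (D a \<theta>)\<^sup>2)) {0..2 * pi}"
    by (intro has_integral_mult_right integrable_integral integrable_continuous_real continuous_intros contD)
  ultimately have "(g has_integral 2 * pi * (1 - e) - 0 + c * integral {0..2 * pi} (\<lambda>\<theta>. (D a \<theta>)\<^sup>2)) {0..2 * pi}"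
    unfolding g_def[abs_def] by (intro has_integral_add has_integral_diff) auto
  moreover have "((\<lambda>\<theta>. 1 / speed (radius s \<theta>) \<theta>) has_integral period s) {0..2 * pi}"
    unfolding period_def by (rule integrable_integral[OF integrable_inverse_speed[OF s]])
  moreover have "g \<theta> \<le> 1 / speed (radius s \<theta>) \<theta>" for \<theta>
  proof -
    define v where "v = speed (radius s \<theta>) \<theta>"
    have "g \<theta> \<le> 2 - v"
      using speed_expansion[OF s a vanish m, of \<theta>] unfolding g_def v_def c_def e_def by linarith
    moreover have "0 < v"
      using speed_near_1(2)[of "radius s \<theta>" \<theta>] radius_spec[OF s, of \<theta>] by (simp add: v_def)
    moreover have "0 \<le> (v - 1)\<^sup>2"
      by simp
    ultimately have "2 - v \<le> 1 / v"
      by (simp add: field_simps power2_eq_square)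
    then show ?thesis
      using \<open>g \<theta> \<le> 2 - v\<close> by (simp add: v_def)
  qed
  ultimately have "2 * pi * (1 - e) - 0 + c * integral {0..2 * pi} (\<lambda>\<theta>. (D a \<theta>)\<^sup>2) \<le> period s"
    by (rule has_integral_le)
  then show ?thesis
    by (simp add: c_def e_def algebra_simps)
qed

text \<open>
  A constant period must be \<open>2 * pi\<close>, its limit at the origin. But for the least index \<open>b\<close> with
  \<open>D b\<close> not identically zero, the period exceeds \<open>2 * pi\<close> by an amount of the order of
  \<open>s ^ (2 * m)\<close>, where \<open>m = 2 * b - 1\<close>, which beats the error term for small \<open>s\<close>.
\<close>

lemma period_not_constant:
  assumes a: "a \<in> {1..n}" and nz: "D a \<theta>0 \<noteq> 0"
    and "0 < \<epsilon>" "\<epsilon> \<le> R / 2"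
  shows "\<exists>s. 0 < s \<and> s \<le> \<epsilon> \<and> period s \<noteq> T"
proof (rule ccontr)
  assume "\<not> ?thesis"
  then have const: "period s = T" if "0 < s" "s \<le> \<epsilon>" for s
    using that by auto
  have T: "T = 2 * pi"
  proof -
    have "((\<lambda>s. 16 * real n * B * pi * s) \<longlongrightarrow> 16 * real n * B * pi * 0) (at_right 0)"
      by (intro tendsto_intros)
    moreover have "\<forall>\<^sub>F s in at_right 0. \<bar>T - 2 * pi\<bar> \<le> 16 * real n * B * pi * s"
      unfolding eventually_at_right_field
    proof (intro exI[of _ \<epsilon>] conjI allI impI)
      fix s assume "0 < s" "s < \<epsilon>"
      then show "\<bar>T - 2 * pi\<bar> \<le> 16 * real n * B * pi * s"
        using period_near_2pi[of s] const[of s] assms by simp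
    qed (use assms in auto)
    ultimately have "\<bar>T - 2 * pi\<bar> \<le> 16 * real n * B * pi * 0"
      by (intro tendsto_lowerbound) auto
    then show ?thesis
      by simp
  qed
  define b where "b = (LEAST k. 1 \<le> k \<and> (\<exists>\<theta>. D k \<theta> \<noteq> 0))"
  have b_le: "b \<le> k" if "1 \<le> k" "D k \<theta> \<noteq> 0" for k \<theta>
    unfolding b_def using that by (intro Least_le) auto
  have "\<exists>k. 1 \<le> k \<and> (\<exists>\<theta>. D k \<theta> \<noteq> 0)"
    using a nz by auto
  then have "1 \<le> b \<and> (\<exists>\<theta>. D b \<theta> \<noteq> 0)"
    unfolding b_def by (rule LeastI_ex)
  then obtain \<theta>1 where b: "1 \<le> b" "D b \<theta>1 \<noteq> 0"
    by blast
  have "b \<in> {1..n}"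
    using b_le[of a \<theta>0] a nz b by auto
  have vanish: "D k \<theta> = 0" if "1 \<le> k" "k < b" for k \<theta>
    using b_le[of k \<theta>] that by auto
  define m where "m = 2 * b - 1"
  define I where "I = integral {0..2 * pi} (\<lambda>\<theta>. (D b \<theta>)\<^sup>2)"
  have contD: "continuous_on S (D k)" for S k
    using D_cont continuous_on_subset by blast
  have "0 < I"
  proof -
    \<comment> \<open>A translate of \<open>\<theta>1\<close> in the interval of integration.\<close>
    define \<theta>2 where "\<theta>2 = \<theta>1 - of_int \<lfloor>\<theta>1 / (2 * pi)\<rfloor> * (2 * pi)"
    have "0 \<le> I"
      unfolding I_def by (intro integral_nonneg integrable_continuous_real continuous_intros contD) auto
    moreover have "I \<noteq> 0"
    proof
      assume "I = 0"
      then have zero: "D b \<theta> = 0" if "\<theta> \<in> {0..2 * pi}" for \<theta>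
        using that integral_eq_0_iff[OF continuous_on_power[OF contD[of "{0..2 * pi}" b], of 2]]
        by (simp add: I_def)
      interpret periodic_fun_simple "D b" "2 * pi"
        by standard (rule D_periodic)
      have "D b \<theta>2 = D b \<theta>1"
        unfolding \<theta>2_def by (rule minus_of_int)
      moreover have "\<theta>2 \<in> {0..2 * pi}"
        using floor_divide_lower[of "2 * pi" \<theta>1] floor_divide_upper[of "2 * pi" \<theta>1]
        by (simp add: \<theta>2_def distrib_right)
      ultimately show False
        using zero b by auto
    qed
    ultimately show ?thesis
      by simp
  qed
  define c where "c = 2 / (3 * (2 * real b + 1)) * (1 / 2) ^ (2 * m) * I"
  define C where "C = 4 * (real n)\<^sup>2 * (real n + 1) * B\<^sup>2 * 2 ^ (2 * m + 1) * (2 * pi)"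
  have "0 < c"
    using \<open>0 < I\<close> by (simp add: c_def)
  have "c \<le> C * s" if "0 < s" "s \<le> \<epsilon>" for s
  proof -
    have "2 * pi + 2 / (3 * (2 * real b + 1)) * (s / 2) ^ (2 * m) * I
        - 4 * (real n)\<^sup>2 * (real n + 1) * B\<^sup>2 * (2 * s) ^ (2 * m + 1) * (2 * pi) \<le> 2 * pi"
      using period_lower_bound[of s b m] \<open>b \<in> {1..n}\<close> vanish that assms const[OF that]
      unfolding T I_def m_def by auto
    moreover have "2 / (3 * (2 * real b + 1)) * (s / 2) ^ (2 * m) * I = c * s ^ (2 * m)"
      by (simp add: c_def power_divide)
    moreover have "4 * (real n)\<^sup>2 * (real n + 1) * B\<^sup>2 * (2 * s) ^ (2 * m + 1) * (2 * pi) = C * s * s ^ (2 * m)"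
      by (simp add: C_def power_mult_distrib)
    ultimately have "c * s ^ (2 * m) \<le> C * s * s ^ (2 * m)"
      by linarith
    then show ?thesis
      using that by simp
  qed
  then have "\<forall>\<^sub>F s in at_right 0. c \<le> C * s"
    unfolding eventually_at_right_field using \<open>0 < \<epsilon>\<close> by (intro exI[of _ \<epsilon>]) auto
  moreover have "((\<lambda>s. C * s) \<longlongrightarrow> C * 0) (at_right 0)"
    by (intro tendsto_intros)
  ultimately have "c \<le> C * 0"
    by (intro tendsto_lowerbound) auto
  then show False
    using \<open>0 < c\<close> by simp
qed

end

section \<open>Hamiltonian fields with even nonlinear terms\<close>

lemma X_hom_scale: "X_hom p r (of_real t * x) = of_real t ^ r * X_hom p r x"
proof -
  have "p (int r - int j - 1) j * (of_real t * x) ^ (r - j) * cnj (of_real t * x) ^ j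
      = of_real t ^ r * (p (int r - int j - 1) j * x ^ (r - j) * cnj x ^ j)" if "j \<le> r" for j
  proof -
    have "(of_real t :: complex) ^ r = of_real t ^ (r - j) * of_real t ^ j"
      using that by (simp flip: power_add)
    then show ?thesis
      by (simp add: power_mult_distrib)
  qed
  then show ?thesis
    unfolding X_hom_def sum_distrib_left by (intro sum.cong) auto
qed

lemma X_hom_bound:
  assumes "norm x = 1"
  shows "norm (X_hom p r x) \<le> (\<Sum>j\<le>r. norm (p (int r - int j - 1) j))"
  unfolding X_hom_def
  by (rule order_trans[OF norm_sum]) (simp add: norm_mult norm_power assms)

text \<open>
  In the frame rotating with the angle, the imaginary part of a vector is its angular component.
\<close>

definition angular_coeff :: "(int \<Rightarrow> nat \<Rightarrow> complex) \<Rightarrow> nat \<Rightarrow> real \<Rightarrow> real" where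
  "angular_coeff p k \<theta> = Im (cis (- \<theta>) * X_hom p (2 * k) (cis \<theta>))"

lemma angular_coeff_continuous: "continuous_on UNIV (angular_coeff p k)"
  unfolding angular_coeff_def[abs_def] X_hom_def by (intro continuous_intros)

text \<open>
  Adding \<open>pi\<close> to the angle is multiplication by \<open>-1\<close>: it fixes the homogeneous part, which has
  even degree, and reverses the rotating frame.
\<close>

lemma angular_coeff_antiperiodic: "angular_coeff p k (\<theta> + pi) = - angular_coeff p k \<theta>"
proof -
  have "cis (\<theta> + pi) = of_real (-1) * cis \<theta>" "cis (- (\<theta> + pi)) = - cis (- \<theta>)"
    by (auto simp: complex_eq_iff)
  then show ?thesis
    unfolding angular_coeff_def by (simp only: X_hom_scale) simp
qed

lemma eval2_chain:
  assumes u: "(u has_real_derivative u') (at t)" and v: "(v has_real_derivative v') (at t)"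
  shows "((\<lambda>t. eval2 H (u t) (v t)) has_real_derivative
    eval2 (partial_u H) (u t) (v t) * u' + eval2 (partial_v H) (u t) (v t) * v') (at t)"
proof (induction H)
  case 0
  then show ?case
    by (simp add: eval2_def partial_u_def partial_v_def)
next
  case (pCons a H)
  have "eval2 (partial_u (pCons a H)) x y = poly (pderiv a) x + y * eval2 (partial_u H) x y" for x y
    using pCons.hyps by (simp add: partial_u_def map_poly_pCons eval2_pCons)
  moreover have "eval2 (partial_v (pCons a H)) x y = eval2 H x y + y * eval2 (partial_v H) x y" for x y
    by (simp add: partial_v_def pderiv_pCons eval2_def)
  moreover have "((\<lambda>t. poly a (u t)) has_real_derivative poly (pderiv a) (u t) * u') (at t)"
    by (rule DERIV_chain2[OF poly_DERIV u])
  ultimately show ?case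
    using DERIV_add[OF _ DERIV_mult[OF v pCons.IH], of "\<lambda>t. poly a (u t)"]
    by (simp add: eval2_pCons algebra_simps)
qed

locale even_hamiltonian =
  fixes n :: nat and p :: "int \<Rightarrow> nat \<Rightarrow> complex" and H :: "real poly poly"
    and X :: "complex \<Rightarrow> complex"
  assumes X_sum: "X = (\<lambda>x. X_lin x + (\<Sum>k=1..n. X_hom p (2 * k) x))"
    and X_ham: "X = hamiltonian_field H"
begin

abbreviation "D \<equiv> angular_coeff p"

lemma angular_component: "Im (cis (- \<theta>) * X (of_real r * cis \<theta>)) = r * polar_speed n D r \<theta>"
proof -
  have "Im (cis (- \<theta>) * X_hom p (2 * k) (of_real r * cis \<theta>)) = r * (D k \<theta> * r ^ (2 * k - 1))"
    if "k \<in> {1..n}" for k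
  proof -
    have "cis (- \<theta>) * X_hom p (2 * k) (of_real r * cis \<theta>)
        = of_real (r ^ (2 * k)) * (cis (- \<theta>) * X_hom p (2 * k) (cis \<theta>))"
      unfolding X_hom_scale by simp
    then have "Im (cis (- \<theta>) * X_hom p (2 * k) (of_real r * cis \<theta>)) = r ^ (2 * k) * D k \<theta>"
      by (simp only: angular_coeff_def times_complex.simps Re_complex_of_real Im_complex_of_real)
    moreover have "r ^ (2 * k) = r * r ^ (2 * k - 1)"
      using that by (simp flip: power_Suc)
    ultimately show ?thesis
      by simp
  qed
  then have "(\<Sum>k=1..n. Im (cis (- \<theta>) * X_hom p (2 * k) (of_real r * cis \<theta>)))
      = r * (\<Sum>k=1..n. D k \<theta> * r ^ (2 * k - 1))"
    unfolding sum_distrib_left by (rule sum.cong[OF refl])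
  moreover have "cis (- \<theta>) * X_lin (of_real r * cis \<theta>) = \<i> * of_real r"
    by (simp add: X_lin_def mult.left_commute cis_mult)
  ultimately show ?thesis
    unfolding X_sum polar_speed_def by (simp add: distrib_left sum_distrib_left)
qed

text \<open>
  For a Hamiltonian field the radial derivative of the Hamiltonian is the angular component of the
  field, so integrating the angular component along a ray recovers the Hamiltonian.
\<close>

lemma polar_energy_eq:
  "polar_energy n D r \<theta> = eval2 H (r * cos \<theta>) (r * sin \<theta>) - eval2 H 0 0"
proof -
  define h where "h r = eval2 H (r * cos \<theta>) (r * sin \<theta>)" for r
  have h: "(h has_real_derivative r * polar_speed n D r \<theta>) (at r)" for r
  proof -
    have "(h has_real_derivative eval2 (partial_u H) (r * cos \<theta>) (r * sin \<theta>) * cos \<theta>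
        + eval2 (partial_v H) (r * cos \<theta>) (r * sin \<theta>) * sin \<theta>) (at r)"
      unfolding h_def[abs_def] by (rule eval2_chain) (auto intro!: derivative_eq_intros)
    then show ?thesis
      unfolding angular_component[symmetric] X_ham by (simp add: hamiltonian_field_def mult.commute)
  qed
  have "((\<lambda>r. polar_energy n D r \<theta> - h r) has_real_derivative 0) (at r)" for r
    using DERIV_diff[OF polar_energy_deriv[of n D \<theta> r] h[of r]] by simp
  then have "polar_energy n D r \<theta> - h r = polar_energy n D 0 \<theta> - h 0"
    by (intro DERIV_isconst_all[of "\<lambda>r. polar_energy n D r \<theta> - h r"]) auto
  then show ?thesis
    by (simp add: h_def polar_energy_def)
qed

lemma polar_energy_angular_deriv:
  "(polar_energy n D r has_real_derivative - r * Re (cis (- \<theta>) * X (of_real r * cis \<theta>))) (at \<theta>)"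
proof -
  have "((\<lambda>\<theta>. eval2 H (r * cos \<theta>) (r * sin \<theta>)) has_real_derivative
      eval2 (partial_u H) (r * cos \<theta>) (r * sin \<theta>) * (- r * sin \<theta>)
      + eval2 (partial_v H) (r * cos \<theta>) (r * sin \<theta>) * (r * cos \<theta>)) (at \<theta>)"
    by (rule eval2_chain) (auto intro!: derivative_eq_intros)
  then have "((\<lambda>\<theta>. eval2 H (r * cos \<theta>) (r * sin \<theta>) - eval2 H 0 0) has_real_derivative
      - r * Re (cis (- \<theta>) * X (of_real r * cis \<theta>))) (at \<theta>)"
    unfolding X_ham
    by (auto intro!: derivative_eq_intros simp: hamiltonian_field_def algebra_simps)
  then show ?thesis
    by (simp add: polar_energy_eq[abs_def])
qed

text \<open>
  Without angular coefficients the Hamiltonian is that of the harmonic oscillator, and the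
  Hamiltonian determines the field. Here the absence of nonlinear radial components is read off
  from the derivative of the energy in the angle.
\<close>

lemma angular_coeff_nonzero:
  assumes "X \<noteq> X_lin"
  shows "\<exists>k\<in>{1..n}. \<exists>\<theta>. D k \<theta> \<noteq> 0"
proof (rule ccontr)
  assume "\<not> ?thesis"
  then have zero: "D k \<theta> = 0" if "k \<in> {1..n}" for k \<theta>
    using that by blast
  then have speed: "polar_speed n D r \<theta> = 1" and energy: "polar_energy n D r \<theta> = r\<^sup>2 / 2" for r \<theta>
    by (auto simp: polar_speed_def polar_energy_def)
  have "X x = X_lin x" for x
  proof (cases "x = 0")
    case True
    have "X_hom p (2 * k) 0 = 0" if "k \<in> {1..n}" for k
      using X_hom_scale[of p "2 * k" 0 0] that by (simp add: power_0_left)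
    then show ?thesis
      by (simp add: True X_sum)
  next
    case False
    define r where "r = norm x"
    define \<theta> where "\<theta> = Arg x"
    have x: "x = of_real r * cis \<theta>"
      using False by (simp add: r_def \<theta>_def cis_Arg sgn_div_norm scaleR_conv_of_real)
    have "(polar_energy n D r has_real_derivative 0) (at \<theta>)"
      by (simp add: energy[abs_def])
    then have "- r * Re (cis (- \<theta>) * X x) = 0"
      using polar_energy_angular_deriv[of r \<theta>] x DERIV_unique by metis
    then have "Re (cis (- \<theta>) * X x) = 0"
      using False by (simp add: r_def)
    moreover have "Im (cis (- \<theta>) * X x) = r"
      using angular_component[of \<theta> r] by (simp add: x speed)
    ultimately have "cis (- \<theta>) * X x = \<i> * r"
      by (simp add: complex_eq_iff)
    then have "cis \<theta> * (cis (- \<theta>) * X x) = \<i> * (r * cis \<theta>)"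
      by (simp add: mult.commute)
    then show ?thesis
      by (simp add: X_lin_def cis_mult flip: mult.assoc x)
  qed
  then show False
    using assms by blast
qed

end

theorem corollary1:
  fixes n :: nat
    and p :: "int \<Rightarrow> nat \<Rightarrow> complex"
    and H :: "real poly poly"
    and X :: "complex \<Rightarrow> complex"
  assumes "n \<ge> 1"
    and "X = (\<lambda>x. X_lin x + (\<Sum>k=1..n. X_hom p (2 * k) x))"
    and "X = hamiltonian_field H"
    and "hamiltonian_degree H = 2 * n"
    and "X \<noteq> X_lin"
  shows "nonisochronous X"
proof
  interpret even_hamiltonian n p H X
    using assms(2,3) by unfold_locales
  define B where "B = (\<Sum>k=1..n. \<Sum>j\<le>2*k. norm (p (int (2 * k) - int j - 1) j))"
  define R where "R = 1 / (4 * (n * B + 1))"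
  have B: "0 \<le> B"
    unfolding B_def by (intro sum_nonneg) auto
  have D_bound: "\<bar>D k \<theta>\<bar> \<le> B" if "k \<in> {1..n}" for k \<theta>
  proof -
    have "\<bar>D k \<theta>\<bar> \<le> norm (cis (- \<theta>) * X_hom p (2 * k) (cis \<theta>))"
      unfolding angular_coeff_def by (rule abs_Im_le_cmod)
    also have "\<dots> \<le> (\<Sum>j\<le>2*k. norm (p (int (2 * k) - int j - 1) j))"
      using X_hom_bound[of "cis \<theta>" p "2 * k"] by (simp add: norm_mult)
    also have "\<dots> \<le> B"
      unfolding B_def using that
      by (intro member_le_sum[of k "{1..n}" "\<lambda>k. \<Sum>j\<le>2*k. norm (p (int (2 * k) - int j - 1) j)"]
          sum_nonneg) auto
    finally show ?thesis .
  qed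
  have nB: "0 \<le> n * B"
    using B by simp
  interpret small_disc n D B R
  proof
    show "0 < R" "R \<le> 1" "n * B * R \<le> 1 / 4"
      using nB by (auto simp: R_def divide_simps)
  qed (use B D_bound angular_coeff_continuous angular_coeff_antiperiodic in auto)
  assume "isochronous X"
  then obtain U T where U: "open U" "0 \<in> U"
      "\<And>\<gamma> S. \<lbrakk>periodic_orbit X \<gamma> S; range \<gamma> \<subseteq> U\<rbrakk> \<Longrightarrow> S = T"
    unfolding isochronous_def by blast
  then obtain \<epsilon> where \<epsilon>: "0 < \<epsilon>" "ball 0 \<epsilon> \<subseteq> U"
    using open_contains_ball by blast
  obtain a \<theta>0 where "a \<in> {1..n}" "D a \<theta>0 \<noteq> 0"
    using angular_coeff_nonzero[OF \<open>X \<noteq> X_lin\<close>] by blast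
  moreover have "0 < min (R / 2) (\<epsilon> / 4)"
    using R \<epsilon> by simp
  ultimately obtain s where s: "0 < s" "s \<le> min (R / 2) (\<epsilon> / 4)" "period s \<noteq> T"
    using period_not_constant[of a \<theta>0 "min (R / 2) (\<epsilon> / 4)" T] min.cobounded1 by blast
  then have "s \<le> R / 2"
    by simp
  then obtain \<gamma> where \<gamma>: "periodic_orbit X \<gamma> (period s)" "\<And>t. norm (\<gamma> t) \<le> 2 * s"
    using level_curve_periodic_orbit[OF s(1), of X] angular_component polar_energy_angular_deriv
    by blast
  have "norm (\<gamma> t) < \<epsilon>" for t
    using \<gamma>(2)[of t] s \<epsilon> by simp
  then have "range \<gamma> \<subseteq> U"
    using \<epsilon>(2) by auto
  then show False
    using U(3)[OF \<gamma>(1)] s(3) by blast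
qed

end
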